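(* Let $\mathcal X$ be a nonempty convex subset of a Euclidean space $E$, and let $F$ be a continuous monotone vector field on $\mathcal X$, with $(F,\mathcal X)$ given by a $\mathcal K$-representation $$Xx+Gg+tT+Uu\leq_{\mathbf K}a\qquad[\mathbf K\in\mathcal K].$$ Let $\xi\mapsto A\xi+b$ be an affine mapping from a Euclidean space $\Lambda$ to $E$, and let $\Xi=\{\xi\in\Lambda: A\xi+b\in\mathcal X\}$ be nonempty. Then the vector field $\Phi(\xi)=A^TF(A\xi+b):\Xi\to\Lambda$ is continuous and monotone, and the conic constraint $$\tau=t-\langle g,b\rangle,\qquad\gamma=A^Tg,\qquad X(A\xi+b)+Gg+tT+Uu\leq_{\mathbf K}a$$ in variables $\tau,\gamma,\xi$ and additional variables $g,t,u$ is a $\mathcal K$-representation of $(\Phi,\Xi)$ (with $\tau,\gamma,\xi$ in the roles of $t,g,x$). If the given constraint is an almost $\mathcal K$-representation of $(F,\mathcal X)$, then the resulting constraint is an almost $\mathcal K$-representation of $(\Phi,\Xi)$.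
   Context: $\mathcal K$ is a fixed family of regular cones (closed, convex, pointed, with nonempty interior) in Euclidean spaces which contains $\mathbb R_+$, is closed under finite direct products, and is closed under passing to dual cones. $a\leq_{\mathbf K}b$ means $b-a\in\mathbf K$. $A^T$ is the adjoint of $A$. Finite systems of conic constraints with cones from $\mathcal K$, linear equalities and nonstrict linear inequalities are equivalent to a single conic constraint with a cone from $\mathcal K$. Let $\mathcal X$ be a nonempty convex subset of a Euclidean space $E$. A vector field $F:\mathcal X\to E$ is monotone if $\langle F(x)-F(y),x-y\rangle\geq0$ for all $x,y\in\mathcal X$. For continuous monotone $F$ put $$\mathcal F[F,\mathcal X]=\{[t;g;x]\in\mathbb R\times E\times E: x\in\mathcal X,\ t-\langle g,y\rangle\geq\langle F(y),x-y\rangle\ \forall y\in\mathcal X\}.$$ A conic constraint $Xx+Gg+tT+Uu\leq_{\mathbf K}a$, $\mathbf K\in\mathcal K$ (or an equivalent finite system), in variables $t,g,x$ and additional variables $u$, with projection $\mathcal T$ of its solution set on the space of $[t;g;x]$, is a $\mathcal K$-representation of $(F,\mathcal X)$ if (i) $\mathcal T\subset\mathcal F[F,\mathcal X]$ and $[t;g;x]\in\mathcal T$, $t'\geq t$ imply $[t';g;x]\in\mathcal T$; and (ii) $\mathcal T\supset\{[\langle F(x),x\rangle;F(x);x]:x\in\mathcal X\}$. It is an almost $\mathcal K$-representation if (i) holds and (ii') $\mathcal T\supset\{[t;F(x);x]:x\in\mathcal X,\ t>\langle F(x),x\rangle\}$. *)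

theory Defs
  imports "HOL-Analysis.Analysis" "HOL-Analysis.Finite_Function_Topology"
begin

section \<open>Coordinate spaces and regular cones\<close>

text \<open>
  A family of cones living in Euclidean spaces of different dimensions cannot be a set of sets over
  one \<open>euclidean_space\<close> type. The ambient spaces of the cones are therefore the coordinate spaces
  \<open>Rn n\<close>, realised as subspaces of the finitely supported real sequences; by choosing orthonormal
  coordinates every Euclidean space is one of them. The library norm on finitely supported
  sequences is the sum of absolute values, which induces the usual topology on each \<open>Rn n\<close>.
\<close>

type_synonym rseq = "nat \<Rightarrow>\<^sub>0 real"

definition Rn :: "nat \<Rightarrow> rseq set" where
  "Rn n = {x. \<forall>i\<ge>n. Poly_Mapping.lookup x i = 0}"

definition regular_cone :: "nat \<Rightarrow> rseq set \<Rightarrow> bool" where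
  "regular_cone n C \<longleftrightarrow>
     C \<subseteq> Rn n \<and> cone C \<and> convex C \<and> closed C \<and>
     (\<forall>x\<in>C. - x \<in> C \<longrightarrow> x = 0) \<and>
     (top_of_set (Rn n)) interior_of C \<noteq> {}"

definition nonneg_ray :: "rseq set" where
  "nonneg_ray = {x \<in> Rn 1. 0 \<le> Poly_Mapping.lookup x 0}"

text \<open>The direct product of \<open>C \<subseteq> Rn m\<close> and \<open>D \<subseteq> Rn n\<close>, as a subset of \<open>Rn (m + n)\<close>.\<close>

definition prod_cone :: "nat \<Rightarrow> rseq set \<Rightarrow> rseq set \<Rightarrow> rseq set" where
  "prod_cone m C D =
     {z. \<exists>x\<in>C. \<exists>y\<in>D. (\<forall>i<m. Poly_Mapping.lookup z i = Poly_Mapping.lookup x i) \<and>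
                       (\<forall>i. Poly_Mapping.lookup z (m + i) = Poly_Mapping.lookup y i)}"

definition dual_cone :: "nat \<Rightarrow> rseq set \<Rightarrow> rseq set" where
  "dual_cone n C =
     {y \<in> Rn n. \<forall>x\<in>C. 0 \<le> (\<Sum>i<n. Poly_Mapping.lookup y i * Poly_Mapping.lookup x i)}"

text \<open>\<open>\<K> n\<close> is the set of those members of the family whose ambient space is \<open>Rn n\<close>.\<close>

definition cone_family :: "(nat \<Rightarrow> rseq set set) \<Rightarrow> bool" where
  "cone_family \<K> \<longleftrightarrow>
     (\<forall>n. \<forall>C\<in>\<K> n. regular_cone n C) \<and>
     nonneg_ray \<in> \<K> 1 \<and>
     (\<forall>m n. \<forall>C\<in>\<K> m. \<forall>D\<in>\<K> n. prod_cone m C D \<in> \<K> (m + n)) \<and>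
     (\<forall>n. \<forall>C\<in>\<K> n. dual_cone n C \<in> \<K> n)"

definition cone_le :: "rseq set \<Rightarrow> rseq \<Rightarrow> rseq \<Rightarrow> bool" where
  "cone_le C a b \<longleftrightarrow> b - a \<in> C"

section \<open>Conic representations of monotone vector fields\<close>

text \<open>
  A system of constraints in variables \<open>v\<close> is identified with its solution set, so that equivalent
  systems are equal; the predicate below says that a system is equivalent to a single conic
  constraint with a cone from \<open>\<K>\<close>.
\<close>

definition conic_system :: "(nat \<Rightarrow> rseq set set) \<Rightarrow> 'v::euclidean_space set \<Rightarrow> bool" where
  "conic_system \<K> S \<longleftrightarrow>
     (\<exists>n. \<exists>C\<in>\<K> n. \<exists>L a. linear L \<and> range L \<subseteq> Rn n \<and> a \<in> Rn n \<and>
        S = {v. cone_le C (L v) a})"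

definition monotone_field :: "'e::euclidean_space set \<Rightarrow> ('e \<Rightarrow> 'e) \<Rightarrow> bool" where
  "monotone_field X F \<longleftrightarrow> (\<forall>x\<in>X. \<forall>y\<in>X. 0 \<le> (F x - F y) \<bullet> (x - y))"

definition field_set :: "('e::euclidean_space \<Rightarrow> 'e) \<Rightarrow> 'e set \<Rightarrow> (real \<times> 'e \<times> 'e) set" where
  "field_set F X = {(t, g, x). x \<in> X \<and> (\<forall>y\<in>X. F y \<bullet> (x - y) \<le> t - g \<bullet> y)}"

text \<open>
  Elements of \<open>S\<close> are pairs of a point \<open>(t, g, x)\<close> and a value \<open>u\<close> of the additional variables, so
  \<open>fst ` S\<close> is the projection of the solution set on the space of \<open>(t, g, x)\<close>.
\<close>

definition rep_condition_i ::
  "((real \<times> 'e \<times> 'e) \<times> 'u::euclidean_space) set \<Rightarrow> ('e::euclidean_space \<Rightarrow> 'e) \<Rightarrow> 'e set \<Rightarrow> bool"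
where
  "rep_condition_i S F X \<longleftrightarrow>
     fst ` S \<subseteq> field_set F X \<and>
     (\<forall>t t' g x. (t, g, x) \<in> fst ` S \<longrightarrow> t \<le> t' \<longrightarrow> (t', g, x) \<in> fst ` S)"

definition K_representation ::
  "(nat \<Rightarrow> rseq set set) \<Rightarrow> ((real \<times> 'e \<times> 'e) \<times> 'u::euclidean_space) set \<Rightarrow>
   ('e::euclidean_space \<Rightarrow> 'e) \<Rightarrow> 'e set \<Rightarrow> bool"
where
  "K_representation \<K> S F X \<longleftrightarrow>
     conic_system \<K> S \<and> rep_condition_i S F X \<and>
     {(F x \<bullet> x, F x, x) |x. x \<in> X} \<subseteq> fst ` S"

definition almost_K_representation ::
  "(nat \<Rightarrow> rseq set set) \<Rightarrow> ((real \<times> 'e \<times> 'e) \<times> 'u::euclidean_space) set \<Rightarrow>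
   ('e::euclidean_space \<Rightarrow> 'e) \<Rightarrow> 'e set \<Rightarrow> bool"
where
  "almost_K_representation \<K> S F X \<longleftrightarrow>
     conic_system \<K> S \<and> rep_condition_i S F X \<and>
     {(t, F x, x) |t x. x \<in> X \<and> F x \<bullet> x < t} \<subseteq> fst ` S"

end

theory Submission
  imports Defs
begin

text \<open>
  Conditions (i) and (ii) transfer because
  \<open>adjoint A g \<bullet> \<eta> = g \<bullet> (A \<eta> + b) - g \<bullet> b\<close>, so the shift \<open>\<tau> = t - g \<bullet> b\<close> turns the
  inequalities defining \<open>field_set F X\<close>, taken at the points \<open>A \<eta> + b\<close>, into those for the
  pulled-back field. That the new system is again conic comes from writing its linear equations
  as pairs of opposite inequalities, i.e. as constraints with the cone of nonnegative reals.
\<close>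

section \<open>Calculus of conic systems\<close>

definition rseq_append :: "nat \<Rightarrow> rseq \<Rightarrow> rseq \<Rightarrow> rseq" where
  "rseq_append m x y =
     Abs_poly_mapping (\<lambda>i. if i < m then Poly_Mapping.lookup x i else Poly_Mapping.lookup y (i - m))"

text \<open>\<open>Abs_poly_mapping\<close> returns the intended function only when its support is
  finite. Here the support lies in the first \<open>m\<close> indices together with the support of
  \<open>y\<close> shifted by \<open>m\<close>.\<close>

lemma lookup_rseq_append:
  "Poly_Mapping.lookup (rseq_append m x y) i =
     (if i < m then Poly_Mapping.lookup x i else Poly_Mapping.lookup y (i - m))"
proof -
  let ?h = "\<lambda>i. if i < m then Poly_Mapping.lookup x i else Poly_Mapping.lookup y (i - m)"
  have "{i. ?h i \<noteq> 0} \<subseteq> {..<m} \<union> (+) m ` {i. Poly_Mapping.lookup y i \<noteq> 0}"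
  proof
    fix i assume "i \<in> {i. ?h i \<noteq> 0}"
    then show "i \<in> {..<m} \<union> (+) m ` {i. Poly_Mapping.lookup y i \<noteq> 0}"
      by (cases "i < m") (auto intro!: image_eqI[of _ _ "i - m"])
  qed
  then have "finite {i. ?h i \<noteq> 0}"
    by (rule finite_subset) simp
  then show ?thesis
    by (simp add: rseq_append_def)
qed

lemma lookup_scaleR:
  "Poly_Mapping.lookup (r *\<^sub>R x) i = r * Poly_Mapping.lookup x i"
  for x :: "'a \<Rightarrow>\<^sub>0 real"
proof -
  have "finite {i. r * Poly_Mapping.lookup x i \<noteq> 0}"
    by (rule finite_subset[OF _ finite_lookup[of x]]) auto
  then show ?thesis
    by (simp add: scaleR_poly_mapping_def)
qed

lemma rseq_append_diff:
  "rseq_append m x y - rseq_append m x' y' = rseq_append m (x - x') (y - y')"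
  by (rule poly_mapping_eqI) (simp add: lookup_rseq_append lookup_minus)

lemma rseq_append_in_Rn:
  assumes "y \<in> Rn n"
  shows "rseq_append m x y \<in> Rn (m + n)"
  using assms by (auto simp: Rn_def lookup_rseq_append)

lemma linear_rseq_append:
  assumes "linear f" and "linear g"
  shows "linear (\<lambda>v. rseq_append m (f v) (g v))"
  by (rule linearI; rule poly_mapping_eqI)
    (simp_all add: lookup_rseq_append lookup_add lookup_scaleR linear_add[OF assms(1)] linear_add[OF assms(2)]
      linear_scale[OF assms(1)] linear_scale[OF assms(2)])

text \<open>Concatenation drops the entries of \<open>x\<close> from index \<open>m\<close> on.
  Since \<open>x\<close> and the members of \<open>C\<close> vanish there, agreement on the first
  \<open>m\<close> entries already identifies them.\<close>

lemma rseq_append_in_prod_cone_iff: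
  assumes "C \<subseteq> Rn m" and "x \<in> Rn m"
  shows "rseq_append m x y \<in> prod_cone m C D \<longleftrightarrow> x \<in> C \<and> y \<in> D"
proof
  assume "rseq_append m x y \<in> prod_cone m C D"
  then obtain x' y' where "x' \<in> C" "y' \<in> D"
    and x': "\<And>i. i < m \<Longrightarrow> Poly_Mapping.lookup x i = Poly_Mapping.lookup x' i"
    and y': "\<And>i. Poly_Mapping.lookup y i = Poly_Mapping.lookup y' i"
    by (auto simp: prod_cone_def lookup_rseq_append)
  have "x = x'"
  proof (rule poly_mapping_eqI)
    fix i
    show "Poly_Mapping.lookup x i = Poly_Mapping.lookup x' i"
      using x'[of i] assms \<open>x' \<in> C\<close> by (cases "i < m") (auto simp: Rn_def subset_iff)
  qed
  moreover have "y = y'"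
    using y' by (rule poly_mapping_eqI)
  ultimately show "x \<in> C \<and> y \<in> D"
    using \<open>x' \<in> C\<close> \<open>y' \<in> D\<close> by simp
next
  assume "x \<in> C \<and> y \<in> D"
  then show "rseq_append m x y \<in> prod_cone m C D"
    unfolding prod_cone_def by (simp add: lookup_rseq_append) blast
qed

section \<open>Conic systems: intersections, linear constraints, affine preimages\<close>

lemma Rn_diff: "x \<in> Rn n \<Longrightarrow> y \<in> Rn n \<Longrightarrow> x - y \<in> Rn n"
  by (simp add: Rn_def lookup_minus)

text \<open>Two constraints are stacked into one by concatenating their linear maps and right-hand
  sides; the cone is the direct product, which stays in the family.\<close>

lemma conic_system_Int:
  assumes \<K>: "cone_family \<K>" and "conic_system \<K> S" and "conic_system \<K> S'"
  shows "conic_system \<K> (S \<inter> S')"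
proof -
  obtain m C L a where C: "C \<in> \<K> m" and L: "linear L" "range L \<subseteq> Rn m" "a \<in> Rn m"
    and S: "S = {v. cone_le C (L v) a}"
    using assms(2) unfolding conic_system_def by blast
  obtain n D L' a' where D: "D \<in> \<K> n" and L': "linear L'" "range L' \<subseteq> Rn n" "a' \<in> Rn n"
    and S': "S' = {v. cone_le D (L' v) a'}"
    using assms(3) unfolding conic_system_def by blast
  have "C \<subseteq> Rn m"
    using \<K> C by (auto simp: cone_family_def regular_cone_def)
  \<comment> \<open>The splitting criterion for \<open>prod_cone\<close> requires the first block to
    lie in \<open>Rn m\<close>; that block is the residual \<open>a - L v\<close>.\<close>
  moreover have "a - L v \<in> Rn m" for v
    using L by (intro Rn_diff) auto
  ultimately have "S \<inter> S' =
      {v. cone_le (prod_cone m C D) (rseq_append m (L v) (L' v)) (rseq_append m a a')}"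
    by (auto simp: S S' cone_le_def rseq_append_diff rseq_append_in_prod_cone_iff)
  moreover have "prod_cone m C D \<in> \<K> (m + n)"
    using \<K> C D by (auto simp: cone_family_def)
  moreover have "linear (\<lambda>v. rseq_append m (L v) (L' v))"
    using L(1) L'(1) by (rule linear_rseq_append)
  moreover have "range (\<lambda>v. rseq_append m (L v) (L' v)) \<subseteq> Rn (m + n)"
    using L'(2) by (auto intro!: rseq_append_in_Rn)
  moreover have "rseq_append m a a' \<in> Rn (m + n)"
    using L'(3) by (rule rseq_append_in_Rn)
  ultimately show ?thesis
    unfolding conic_system_def by blast
qed

text \<open>Scalars are placed in coordinate 0, so that the residual \<open>c - f v\<close> becomes
  a point of \<open>Rn 1\<close> to be tested against \<open>nonneg_ray\<close>.\<close>

lemma conic_system_linear_le: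
  fixes f :: "'v::euclidean_space \<Rightarrow> real"
  assumes \<K>: "cone_family \<K>" and f: "linear f"
  shows "conic_system \<K> {v. f v \<le> c}"
proof -
  have single_Rn: "Poly_Mapping.single 0 r \<in> Rn 1" for r :: real
    by (simp add: Rn_def lookup_single when_def)
  have "linear (\<lambda>v. Poly_Mapping.single (0::nat) (f v))"
    by (rule linearI; rule poly_mapping_eqI)
      (simp_all add: lookup_single lookup_add lookup_scaleR when_def linear_add[OF f] linear_scale[OF f])
  moreover have "{v. f v \<le> c} =
      {v. cone_le nonneg_ray (Poly_Mapping.single 0 (f v)) (Poly_Mapping.single 0 c)}"
    by (auto simp: cone_le_def nonneg_ray_def lookup_minus intro!: Rn_diff single_Rn[simplified])
  moreover have "nonneg_ray \<in> \<K> 1"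
    using \<K> by (simp add: cone_family_def)
  moreover have "range (\<lambda>v. Poly_Mapping.single 0 (f v)) \<subseteq> Rn 1"
    using single_Rn by blast
  ultimately show ?thesis
    using single_Rn unfolding conic_system_def by blast
qed

lemma conic_system_INT:
  assumes "cone_family \<K>" and "finite I" and "\<And>i. i \<in> I \<Longrightarrow> conic_system \<K> (S i)"
  shows "conic_system \<K> (\<Inter>i\<in>I. S i)"
  using assms(2,3)
proof (induction I rule: finite_induct)
  case empty
  \<comment> \<open>The empty intersection is the whole space, represented by the trivial inequality
    0 \<le> 0.\<close>
  have "conic_system \<K> {v::'b. (\<lambda>_. 0) v \<le> (0::real)}"
    by (rule conic_system_linear_le[OF assms(1) linear_zero])
  then show ?case by simp
next
  case (insert i I)
  then show ?case
    by (simp add: conic_system_Int[OF assms(1)])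
qed

text \<open>For n > 0 the cone {0} in \<open>Rn n\<close> has empty interior, so it is not regular
  and cannot express an equation directly. Each coordinate of \<open>M v\<close> is bounded by 0
  from both sides instead.\<close>

lemma conic_system_linear_eq_0:
  fixes M :: "'v::euclidean_space \<Rightarrow> 'w::euclidean_space"
  assumes "cone_family \<K>" and "linear M"
  shows "conic_system \<K> {v. M v = 0}"
proof -
  have "linear (\<lambda>v. M v \<bullet> i)" "linear (\<lambda>v. - (M v \<bullet> i))" for i
    by (rule linearI;
        simp add: linear_add[OF assms(2)] linear_scale[OF assms(2)] inner_add_left)+
  then have "conic_system \<K> (\<Inter>i\<in>Basis. {v. M v \<bullet> i \<le> 0} \<inter> {v. - (M v \<bullet> i) \<le> 0})"
    by (intro conic_system_INT conic_system_Int conic_system_linear_le finite_Basis assms(1))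
  also have "(\<Inter>i\<in>Basis. {v. M v \<bullet> i \<le> 0} \<inter> {v. - (M v \<bullet> i) \<le> 0}) = {v. M v = 0}"
    using euclidean_all_zero_iff by (fastforce intro: order_antisym)
  finally show ?thesis .
qed

text \<open>The cone is kept and the constant moves to the right-hand side:
  \<open>a - L (M v + c) = (a - L c) - L (M v)\<close>.\<close>

lemma conic_system_affine_preimage:
  fixes M :: "'v::euclidean_space \<Rightarrow> 'w::euclidean_space"
  assumes "conic_system \<K> S" and M: "linear M"
  shows "conic_system \<K> {v. M v + c \<in> S}"
proof -
  obtain n C L a where C: "C \<in> \<K> n" and L: "linear L" "range L \<subseteq> Rn n" "a \<in> Rn n"
    and S: "S = {v. cone_le C (L v) a}"
    using assms(1) unfolding conic_system_def by blast
  have "linear (L \<circ> M)"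
    using M L(1) by (rule linear_compose)
  moreover have "{v. M v + c \<in> S} = {v. cone_le C ((L \<circ> M) v) (a - L c)}"
    by (simp add: S cone_le_def linear_add[OF L(1)] algebra_simps)
  moreover have "range (L \<circ> M) \<subseteq> Rn n"
    using L(2) by auto
  moreover have "a - L c \<in> Rn n"
    using L by (intro Rn_diff) auto
  ultimately show ?thesis
    using C unfolding conic_system_def by blast
qed

section \<open>Pulling back a field along an affine map\<close>

context
  fixes A :: "'l::euclidean_space \<Rightarrow> 'e::euclidean_space" and b :: 'e
  assumes A: "linear A"
begin

text \<open>The old \<open>t\<close> and \<open>g\<close> are no longer among the main variables, so
  they join \<open>u\<close> as additional ones. An arbitrary solution set \<open>S\<close> is
  allowed, which separates the substitution from the particular conic form of the
  constraint.\<close>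

definition pullback_system ::
  "((real \<times> 'e \<times> 'e) \<times> 'u::euclidean_space) set \<Rightarrow>
   ((real \<times> 'l \<times> 'l) \<times> ('e \<times> real \<times> 'u)) set"
where
  "pullback_system S = {((\<tau>, \<gamma>, \<xi>), (g, t, u)).
     \<tau> = t - g \<bullet> b \<and> \<gamma> = adjoint A g \<and> ((t, g, A \<xi> + b), u) \<in> S}"

lemma adjoint_inner: "adjoint A g \<bullet> \<xi> = g \<bullet> A \<xi>"
  using adjoint_works[OF A] by (simp add: inner_commute)

text \<open>The equation for \<tau> determines t as \<open>\<tau> + g \<bullet> b\<close>, so only
  \<open>g\<close> and \<open>u\<close> remain to be chosen, and \<open>u\<close> is absorbed into
  the projection of \<open>S\<close>.\<close>

lemma in_fst_pullback_system_iff: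
  "(\<tau>, \<gamma>, \<xi>) \<in> fst ` pullback_system S \<longleftrightarrow>
     (\<exists>g. \<gamma> = adjoint A g \<and> (\<tau> + g \<bullet> b, g, A \<xi> + b) \<in> fst ` S)"
  by (force simp: pullback_system_def image_iff)

lemma conic_system_pullback:
  fixes S :: "((real \<times> 'e \<times> 'e) \<times> 'u::euclidean_space) set"
  assumes "cone_family \<K>" and "conic_system \<K> S"
  shows "conic_system \<K> (pullback_system S)"
proof -
  \<comment> \<open>\<open>M\<close> extracts the arguments of the old constraint up to the constant
    shift by \<open>b\<close>, and \<open>N\<close> collects the two equations as differences. With
    \<open>b\<close> fixed, \<open>g \<bullet> b\<close> is linear in \<open>g\<close>, so
    \<open>N\<close> is homogeneous.\<close>
  define M :: "(real \<times> 'l \<times> 'l) \<times> ('e \<times> real \<times> 'u) \<Rightarrow> (real \<times> 'e \<times> 'e) \<times> 'u"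
    where "M = (\<lambda>((\<tau>, \<gamma>, \<xi>), (g, t, u)). ((t, g, A \<xi>), u))"
  define N :: "(real \<times> 'l \<times> 'l) \<times> ('e \<times> real \<times> 'u) \<Rightarrow> real \<times> 'l"
    where "N = (\<lambda>((\<tau>, \<gamma>, \<xi>), (g, t, u)). (\<tau> - t + g \<bullet> b, \<gamma> - adjoint A g))"
  note A' = adjoint_linear[OF A]
  have "linear M"
    by (rule linearI) (auto simp: M_def linear_add[OF A] linear_scale[OF A])
  moreover have "linear N"
    by (rule linearI)
      (auto simp: N_def linear_add[OF A'] linear_scale[OF A'] inner_add_left algebra_simps)
  moreover have "pullback_system S = {v. M v + ((0, 0, b), 0) \<in> S} \<inter> {v. N v = 0}"
    by (auto simp: pullback_system_def M_def N_def zero_prod_def)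
  ultimately show ?thesis
    using assms
    by (simp add: conic_system_Int conic_system_affine_preimage conic_system_linear_eq_0)
qed

section \<open>Transfer of conditions (i), (ii) and (ii')\<close>

lemma rep_condition_i_pullback:
  assumes "rep_condition_i S F X"
  shows "rep_condition_i (pullback_system S) (\<lambda>\<xi>. adjoint A (F (A \<xi> + b))) {\<xi>. A \<xi> + b \<in> X}"
  unfolding rep_condition_i_def
proof (intro conjI allI impI subsetI)
  fix p assume p_in: "p \<in> fst ` pullback_system S"
  obtain \<tau> \<gamma> \<xi> where p: "p = (\<tau>, \<gamma>, \<xi>)"
    by (cases p)
  obtain g where g: "\<gamma> = adjoint A g" "(\<tau> + g \<bullet> b, g, A \<xi> + b) \<in> fst ` S"
    using p_in unfolding p in_fst_pullback_system_iff by blast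
  have "(\<tau> + g \<bullet> b, g, A \<xi> + b) \<in> field_set F X"
    using assms g(2) by (auto simp: rep_condition_i_def)
  then have \<xi>: "A \<xi> + b \<in> X"
    and le: "\<And>y. y \<in> X \<Longrightarrow> F y \<bullet> (A \<xi> + b - y) \<le> \<tau> + g \<bullet> b - g \<bullet> y"
    by (auto simp: field_set_def)
  \<comment> \<open>Only test points \<open>y = A \<eta> + b\<close> matter: then
    \<open>A \<xi> + b - y = A (\<xi> - \<eta>)\<close>, and on the right
    \<open>g \<bullet> b\<close> cancels, leaving
    \<open>\<tau> - g \<bullet> A \<eta>\<close>.\<close>
  have "adjoint A (F (A \<eta> + b)) \<bullet> (\<xi> - \<eta>) \<le> \<tau> - \<gamma> \<bullet> \<eta>" if "A \<eta> + b \<in> X" for \<eta>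
    using le[OF that] by (simp add: g(1) adjoint_inner linear_diff[OF A] inner_add_right)
  then show "p \<in> field_set (\<lambda>\<xi>. adjoint A (F (A \<xi> + b))) {\<xi>. A \<xi> + b \<in> X}"
    using \<xi> by (simp add: p field_set_def)
next
  fix \<tau> \<tau>' \<gamma> \<xi>
  assume "(\<tau>, \<gamma>, \<xi>) \<in> fst ` pullback_system S" and "\<tau> \<le> \<tau>'"
  then obtain g where g: "\<gamma> = adjoint A g" "(\<tau> + g \<bullet> b, g, A \<xi> + b) \<in> fst ` S"
    unfolding in_fst_pullback_system_iff by blast
  \<comment> \<open>The same \<open>g\<close> serves for \<tau>', because the shift between \<tau>
    and t depends on \<open>g\<close> alone.\<close>
  have "\<tau> + g \<bullet> b \<le> \<tau>' + g \<bullet> b"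
    using \<open>\<tau> \<le> \<tau>'\<close> by simp
  then have "(\<tau>' + g \<bullet> b, g, A \<xi> + b) \<in> fst ` S"
    using assms g(2) unfolding rep_condition_i_def by blast
  then show "(\<tau>', \<gamma>, \<xi>) \<in> fst ` pullback_system S"
    using g(1) unfolding in_fst_pullback_system_iff by blast
qed

text \<open>The witness is \<open>g = F (A \<xi> + b)\<close>. The value of t forced by the equation
  for \<tau> is then \<open>g \<bullet> (A \<xi> + b)\<close>, exactly the one that (ii) provides
  for \<open>S\<close>.\<close>

lemma K_representation_pullback:
  assumes "cone_family \<K>" and "K_representation \<K> S F X"
  shows "K_representation \<K> (pullback_system S)
    (\<lambda>\<xi>. adjoint A (F (A \<xi> + b))) {\<xi>. A \<xi> + b \<in> X}"
proof -
  let ?\<Phi> = "\<lambda>\<xi>. adjoint A (F (A \<xi> + b))"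
  have "(?\<Phi> \<xi> \<bullet> \<xi>, ?\<Phi> \<xi>, \<xi>) \<in> fst ` pullback_system S" if "A \<xi> + b \<in> X" for \<xi>
  proof -
    have "(F (A \<xi> + b) \<bullet> (A \<xi> + b), F (A \<xi> + b), A \<xi> + b) \<in> fst ` S"
      using assms(2) that unfolding K_representation_def by blast
    moreover have "?\<Phi> \<xi> \<bullet> \<xi> + F (A \<xi> + b) \<bullet> b = F (A \<xi> + b) \<bullet> (A \<xi> + b)"
      by (simp add: adjoint_inner inner_add_right)
    ultimately show ?thesis
      unfolding in_fst_pullback_system_iff by metis
  qed
  moreover have "conic_system \<K> (pullback_system S)"
    using assms by (simp add: K_representation_def conic_system_pullback)
  moreover have "rep_condition_i (pullback_system S) ?\<Phi> {\<xi>. A \<xi> + b \<in> X}"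
    using assms(2) by (simp add: K_representation_def rep_condition_i_pullback)
  ultimately show ?thesis
    unfolding K_representation_def by (intro conjI) auto
qed

text \<open>The witness for \<open>g\<close> is again \<open>F (A \<xi> + b)\<close>; adding
  \<open>g \<bullet> b\<close> to both sides preserves the strict inequality in (ii').\<close>

lemma almost_K_representation_pullback:
  assumes "cone_family \<K>" and "almost_K_representation \<K> S F X"
  shows "almost_K_representation \<K> (pullback_system S)
    (\<lambda>\<xi>. adjoint A (F (A \<xi> + b))) {\<xi>. A \<xi> + b \<in> X}"
proof -
  let ?\<Phi> = "\<lambda>\<xi>. adjoint A (F (A \<xi> + b))"
  have "(\<tau>, ?\<Phi> \<xi>, \<xi>) \<in> fst ` pullback_system S"
    if "A \<xi> + b \<in> X" and "?\<Phi> \<xi> \<bullet> \<xi> < \<tau>" for \<tau> \<xi>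
  proof -
    have "F (A \<xi> + b) \<bullet> (A \<xi> + b) < \<tau> + F (A \<xi> + b) \<bullet> b"
      using that(2) by (simp add: adjoint_inner inner_add_right)
    then have "(\<tau> + F (A \<xi> + b) \<bullet> b, F (A \<xi> + b), A \<xi> + b) \<in> fst ` S"
      using assms(2) that(1) unfolding almost_K_representation_def by blast
    then show ?thesis
      unfolding in_fst_pullback_system_iff by metis
  qed
  moreover have "conic_system \<K> (pullback_system S)"
    using assms by (simp add: almost_K_representation_def conic_system_pullback)
  moreover have "rep_condition_i (pullback_system S) ?\<Phi> {\<xi>. A \<xi> + b \<in> X}"
    using assms(2) by (simp add: almost_K_representation_def rep_condition_i_pullback)
  ultimately show ?thesis
    unfolding almost_K_representation_def by (intro conjI) auto
qed

section \<open>Continuity and monotonicity of the pulled-back field\<close>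

lemma continuous_on_pullback:
  assumes "continuous_on X F"
  shows "continuous_on {\<xi>. A \<xi> + b \<in> X} (\<lambda>\<xi>. adjoint A (F (A \<xi> + b)))"
proof -
  have "continuous_on {\<xi>. A \<xi> + b \<in> X} (\<lambda>\<xi>. A \<xi> + b)"
    by (intro continuous_intros linear_continuous_on linear_conv_bounded_linear[THEN iffD1] A)
  then have "continuous_on {\<xi>. A \<xi> + b \<in> X} (\<lambda>\<xi>. F (A \<xi> + b))"
    by (rule continuous_on_compose2[OF assms]) auto
  then show ?thesis
    by (rule bounded_linear.continuous_on
        [OF linear_conv_bounded_linear[THEN iffD1, OF adjoint_linear[OF A]]])
qed

text \<open>Moving the adjoint across the inner product replaces \<open>\<xi> - \<eta>\<close> by
  \<open>A (\<xi> - \<eta>)\<close>, the difference of the two image points since \<open>b\<close>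
  cancels.\<close>

lemma monotone_field_pullback:
  assumes "monotone_field X F"
  shows "monotone_field {\<xi>. A \<xi> + b \<in> X} (\<lambda>\<xi>. adjoint A (F (A \<xi> + b)))"
  unfolding monotone_field_def
proof (intro ballI)
  fix \<xi> \<eta> assume "\<xi> \<in> {\<xi>. A \<xi> + b \<in> X}" and "\<eta> \<in> {\<xi>. A \<xi> + b \<in> X}"
  then have "0 \<le> (F (A \<xi> + b) - F (A \<eta> + b)) \<bullet> ((A \<xi> + b) - (A \<eta> + b))"
    using assms unfolding monotone_field_def by blast
  then show "0 \<le> (adjoint A (F (A \<xi> + b)) - adjoint A (F (A \<eta> + b))) \<bullet> (\<xi> - \<eta>)"
    by (simp add: inner_diff_left adjoint_inner linear_diff[OF A])
qed

end

theorem mainTheorem18: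
  fixes \<K> :: "nat \<Rightarrow> rseq set set"
    and \<X> :: "'e::euclidean_space set"
    and F :: "'e \<Rightarrow> 'e"
    and n :: nat and K :: "rseq set"
    and X G :: "'e \<Rightarrow> rseq" and T :: rseq
    and U :: "'u::euclidean_space \<Rightarrow> rseq" and a :: rseq
    and A :: "'l::euclidean_space \<Rightarrow> 'e" and b :: 'e
  defines "S \<equiv> {((t, g, x), u). cone_le K (X x + G g + t *\<^sub>R T + U u) a}"
    and "\<Xi> \<equiv> {\<xi>. A \<xi> + b \<in> \<X>}"
    and "\<Phi> \<equiv> (\<lambda>\<xi>. adjoint A (F (A \<xi> + b)))"
    and "S' \<equiv> {((\<tau>, \<gamma>, \<xi>), (g, t, u)).
                 \<tau> = t - g \<bullet> b \<and> \<gamma> = adjoint A g \<and>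
                 cone_le K (X (A \<xi> + b) + G g + t *\<^sub>R T + U u) a}"
  assumes "cone_family \<K>"
    and "\<X> \<noteq> {}" and "convex \<X>"
    and "continuous_on \<X> F" and "monotone_field \<X> F"
    and "K \<in> \<K> n"
    and "linear X" and "range X \<subseteq> Rn n"
    and "linear G" and "range G \<subseteq> Rn n"
    and "T \<in> Rn n"
    and "linear U" and "range U \<subseteq> Rn n"
    and "a \<in> Rn n"
    and "linear A"
    and "\<Xi> \<noteq> {}"
  shows "continuous_on \<Xi> \<Phi> \<and> monotone_field \<Xi> \<Phi> \<and>
         (K_representation \<K> S F \<X> \<longrightarrow> K_representation \<K> S' \<Phi> \<Xi>) \<and>
         (almost_K_representation \<K> S F \<X> \<longrightarrow> almost_K_representation \<K> S' \<Phi> \<Xi>)"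
proof -
  \<comment> \<open>The constraint in the statement is the general substitution applied to its own
    solution set. Each representation predicate includes that \<open>S\<close> is conic, which
    supplies the premise of the transfer lemmas.\<close>
  have S': "S' = pullback_system A b S"
    by (simp add: S'_def pullback_system_def[OF \<open>linear A\<close>] S_def)
  show ?thesis
    unfolding S' \<Phi>_def \<Xi>_def
    using \<open>linear A\<close> \<open>cone_family \<K>\<close> \<open>continuous_on \<X> F\<close> \<open>monotone_field \<X> F\<close>
    by (simp add: continuous_on_pullback monotone_field_pullback
        K_representation_pullback almost_K_representation_pullback)
qed

end
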